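(* Consider $n$ trajectories with known lengths, to be partitioned into $m$ groups $g_1,\dots,g_m$, one per worker, on $m$ homogeneous workers, where the interference factor $F(g)$ of a group $g$ is a monotonically increasing function determined exclusively by the size of the group. Presort the trajectories in descending length order, $L(\tau_1)\ge L(\tau_2)\ge\dots\ge L(\tau_n)$, and apply the following dynamic programming, in which $dp[i][j]$ denotes the optimal makespan when partitioning the first $i$ trajectories across $j$ workers (groups being contiguous in the sorted order). Initialization: $dp[0][0]=0$ and $$dp[i][1]=L(\tau_1)\times T\times F(\{\tau_1,\dots,\tau_i\})\qquad (1\le i\le n).$$ State transition (for more than one worker): $$dp[i][j]=\min_{k=1}^{i-1}\max\Big\{dp[k][j-1],\ L(\tau_{k+1})\times T\times F(\{\tau_{k+1},\dots,\tau_i\})\Big\},$$ where the index $k$ assigns $\{\tau_1,\dots,\tau_k\}$ to the preceding $j-1$ workers and $\{\tau_{k+1},\dots,\tau_i\}$ to the $j$-th worker. Then this combination of presorting and dynamic programming yields a globally optimal solution of $$\min_{\{g_1,\dots,g_m\}}\ \max_{i=1}^{m}\Big(F(g_i)\times\max_{\tau\in g_i}L(\tau)\times T\Big),$$ where the minimum is over all (not necessarily contiguous) partitions of the trajectories into $m$ groups. The time complexity of the algorithm is $O(n^2m)$.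
   Context: There are $n$ trajectories (jobs) $\tau_1,\dots,\tau_n$ to be placed on $m$ workers. A partitioning strategy $\{g_1,\dots,g_m\}$ is a partition of the set of trajectories into $m$ groups, group $g_i$ being assigned to the $i$-th worker. $L$ is the trajectory length function, $T$ is the average base per-token time (the per-token time at batch size one), taken to be a constant, and $F(g)$ is the interference factor of group $g$. The completion time of a group $g$ is $F(g)\times\max_{\tau\in g}L(\tau)\times T$, and the makespan of a partition is the maximum of the completion times of its groups. Workers are homogeneous, meaning that all have the same resource configuration. *)

theory Defs
  imports
    "HOL-Library.Extended_Real"
    "HOL-Library.Disjoint_Sets"
    "HOL-Library.Time_Functions"
begin

section \<open>The scheduling problem\<close>

definition partition_strategy :: "'a set \<Rightarrow> nat \<Rightarrow> (nat \<Rightarrow> 'a set) \<Rightarrow> bool" where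
  "partition_strategy A m g \<longleftrightarrow>
     disjoint_family_on g {1..m} \<and> (\<Union>i\<in>{1..m}. g i) = A \<and> (\<forall>i\<in>{1..m}. g i \<noteq> {})"

definition completion_time :: "('a set \<Rightarrow> real) \<Rightarrow> ('a \<Rightarrow> real) \<Rightarrow> real \<Rightarrow> 'a set \<Rightarrow> real" where
  "completion_time F L T g = F g * Max (L ` g) * T"

definition makespan ::
  "('a set \<Rightarrow> real) \<Rightarrow> ('a \<Rightarrow> real) \<Rightarrow> real \<Rightarrow> nat \<Rightarrow> (nat \<Rightarrow> 'a set) \<Rightarrow> real" where
  "makespan F L T m g = Max ((\<lambda>i. completion_time F L T (g i)) ` {1..m})"

text \<open>
  \<open>\<phi> s\<close> is the interference factor of the groups of size \<open>s\<close>. The factor multiplies a running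
  time, so it is nonnegative. Nothing is said about the factor of the empty group.
\<close>

definition size_interference :: "('a set \<Rightarrow> real) \<Rightarrow> (nat \<Rightarrow> real) \<Rightarrow> bool" where
  "size_interference F \<phi> \<longleftrightarrow>
     (\<forall>g. finite g \<and> g \<noteq> {} \<longrightarrow> F g = \<phi> (card g)) \<and>
     mono_on {1..} \<phi> \<and> (\<forall>s\<ge>1. 0 \<le> \<phi> s)"


section \<open>The recurrence\<close>

definition presorted :: "('a \<Rightarrow> real) \<Rightarrow> 'a set \<Rightarrow> (nat \<Rightarrow> 'a) \<Rightarrow> bool" where
  "presorted L A \<tau> \<longleftrightarrow>
     bij_betw \<tau> {1..card A} A \<and> antimono_on {1..card A} (\<lambda>i. L (\<tau> i))"

text \<open>
  States that no rule initializes or that have an empty range of \<open>k\<close> are infeasible and have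
  value \<open>\<infinity>\<close>; in particular the infimum of the empty set is \<open>\<infinity>\<close>.
\<close>

fun dp ::
  "('a set \<Rightarrow> real) \<Rightarrow> ('a \<Rightarrow> real) \<Rightarrow> real \<Rightarrow> (nat \<Rightarrow> 'a) \<Rightarrow> nat \<Rightarrow> nat \<Rightarrow> ereal" where
  "dp F L T \<tau> i 0 = (if i = 0 then 0 else \<infinity>)"
| "dp F L T \<tau> i (Suc 0) =
     (if i = 0 then \<infinity> else ereal (L (\<tau> 1) * T * F (\<tau> ` {1..i})))"
| "dp F L T \<tau> i (Suc (Suc j)) =
     (INF k\<in>{1..i-1}.
        max (dp F L T \<tau> k (Suc j)) (ereal (L (\<tau> (k+1)) * T * F (\<tau> ` {k+1..i}))))"


section \<open>The algorithm\<close>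

fun insert_desc :: "('a \<Rightarrow> real) \<Rightarrow> 'a \<Rightarrow> 'a list \<Rightarrow> 'a list" where
  "insert_desc L x [] = [x]"
| "insert_desc L x (y # ys) = (if L y \<le> L x then x # y # ys else y # insert_desc L x ys)"

fun presort :: "('a \<Rightarrow> real) \<Rightarrow> 'a list \<Rightarrow> 'a list" where
  "presort L [] = []"
| "presort L (x # xs) = insert_desc L x (presort L xs)"

text \<open>
  The table is filled row by row, row \<open>j\<close> being the list of the entries for
  \<open>(1,j), \<dots>, (n,j)\<close>. An entry consists of the value \<open>dp[i][j]\<close> and of the chosen indices \<open>k\<close>,
  last worker first, from which the groups are recovered at the end.
\<close>

type_synonym dp_entry = "ereal \<times> nat list"

fun first_row :: "(nat \<Rightarrow> real) \<Rightarrow> real \<Rightarrow> real \<Rightarrow> nat \<Rightarrow> 'a list \<Rightarrow> dp_entry list" where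
  "first_row \<phi> T l i [] = []"
| "first_row \<phi> T l i (x # xs) = (ereal (l * T * \<phi> i), []) # first_row \<phi> T l (i + 1) xs"

text \<open>
  Minimization over \<open>k, k+1, \<dots>, i-1\<close>. The two lists hold the entries for \<open>(k,j-1)\<close>,
  \<open>(k+1,j-1), \<dots>\<close> and the trajectories \<open>\<tau> (k+1), \<tau> (k+2), \<dots>\<close>.
\<close>

fun best_cut ::
  "(nat \<Rightarrow> real) \<Rightarrow> ('a \<Rightarrow> real) \<Rightarrow> real \<Rightarrow> nat \<Rightarrow> nat \<Rightarrow> dp_entry list \<Rightarrow> 'a list \<Rightarrow> dp_entry" where
  "best_cut \<phi> L T i k [] xs = (\<infinity>, [])"
| "best_cut \<phi> L T i k (p # ps) [] = (\<infinity>, [])"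
| "best_cut \<phi> L T i k (p # ps) (x # xs) =
     (if i \<le> k then (\<infinity>, [])
      else let v = max (fst p) (ereal (L x * T * \<phi> (i - k)));
               r = best_cut \<phi> L T i (k + 1) ps xs
           in if v \<le> fst r then (v, k # snd p) else r)"

fun next_row ::
  "(nat \<Rightarrow> real) \<Rightarrow> ('a \<Rightarrow> real) \<Rightarrow> real \<Rightarrow> dp_entry list \<Rightarrow> 'a list \<Rightarrow> nat \<Rightarrow> 'a list \<Rightarrow> dp_entry list"
where
  "next_row \<phi> L T ps ts i [] = []"
| "next_row \<phi> L T ps ts i (x # xs) =
     best_cut \<phi> L T i 1 ps ts # next_row \<phi> L T ps ts (i + 1) xs"

fun fill_rows ::
  "(nat \<Rightarrow> real) \<Rightarrow> ('a \<Rightarrow> real) \<Rightarrow> real \<Rightarrow> 'a list \<Rightarrow> nat \<Rightarrow> dp_entry list \<Rightarrow> dp_entry list" where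
  "fill_rows \<phi> L T ts 0 ps = ps"
| "fill_rows \<phi> L T ts (Suc j) ps = fill_rows \<phi> L T ts j (next_row \<phi> L T ps (tl ts) 1 ts)"

fun split_groups :: "'a list \<Rightarrow> nat list \<Rightarrow> 'a list list \<Rightarrow> 'a list list" where
  "split_groups ts [] gs = ts # gs"
| "split_groups ts (k # ks) gs = split_groups (take k ts) ks (drop k ts # gs)"

definition solve ::
  "(nat \<Rightarrow> real) \<Rightarrow> ('a \<Rightarrow> real) \<Rightarrow> real \<Rightarrow> nat \<Rightarrow> 'a list \<Rightarrow> ereal \<times> 'a list list" where
  "solve \<phi> L T m xs =
     (let ts = presort L xs;
          row = fill_rows \<phi> L T ts (m - 1) (first_row \<phi> T (L (hd ts)) 1 ts);
          p = row ! (length ts - 1)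
      in (fst p, split_groups ts (snd p) []))"


section \<open>Running time\<close>

text \<open>
  Step counts as produced by the translation of \<^theory>\<open>HOL-Library.Time_Commands\<close>: every call of a
  defined function costs one step plus the steps of the calls that it makes. Arithmetic,
  comparisons, \<open>fst\<close>, \<open>snd\<close>, \<open>hd\<close>, \<open>tl\<close> and the evaluations of \<open>L\<close> and \<open>\<phi>\<close>, of which there are
  boundedly many in each call, are constant-time and therefore count zero.
\<close>

fun T_insert_desc :: "('a \<Rightarrow> real) \<Rightarrow> 'a \<Rightarrow> 'a list \<Rightarrow> nat" where
  "T_insert_desc L x [] = 1"
| "T_insert_desc L x (y # ys) = (if L y \<le> L x then 0 else T_insert_desc L x ys) + 1"

fun T_presort :: "('a \<Rightarrow> real) \<Rightarrow> 'a list \<Rightarrow> nat" where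
  "T_presort L [] = 1"
| "T_presort L (x # xs) = T_presort L xs + T_insert_desc L x (presort L xs) + 1"

fun T_first_row :: "(nat \<Rightarrow> real) \<Rightarrow> real \<Rightarrow> real \<Rightarrow> nat \<Rightarrow> 'a list \<Rightarrow> nat" where
  "T_first_row \<phi> T l i [] = 1"
| "T_first_row \<phi> T l i (x # xs) = T_first_row \<phi> T l (i + 1) xs + 1"

fun T_best_cut ::
  "(nat \<Rightarrow> real) \<Rightarrow> ('a \<Rightarrow> real) \<Rightarrow> real \<Rightarrow> nat \<Rightarrow> nat \<Rightarrow> dp_entry list \<Rightarrow> 'a list \<Rightarrow> nat" where
  "T_best_cut \<phi> L T i k [] xs = 1"
| "T_best_cut \<phi> L T i k (p # ps) [] = 1"
| "T_best_cut \<phi> L T i k (p # ps) (x # xs) =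
     (if i \<le> k then 0 else T_best_cut \<phi> L T i (k + 1) ps xs) + 1"

fun T_next_row ::
  "(nat \<Rightarrow> real) \<Rightarrow> ('a \<Rightarrow> real) \<Rightarrow> real \<Rightarrow> dp_entry list \<Rightarrow> 'a list \<Rightarrow> nat \<Rightarrow> 'a list \<Rightarrow> nat"
where
  "T_next_row \<phi> L T ps ts i [] = 1"
| "T_next_row \<phi> L T ps ts i (x # xs) =
     T_best_cut \<phi> L T i 1 ps ts + T_next_row \<phi> L T ps ts (i + 1) xs + 1"

fun T_fill_rows ::
  "(nat \<Rightarrow> real) \<Rightarrow> ('a \<Rightarrow> real) \<Rightarrow> real \<Rightarrow> 'a list \<Rightarrow> nat \<Rightarrow> dp_entry list \<Rightarrow> nat" where
  "T_fill_rows \<phi> L T ts 0 ps = 1"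
| "T_fill_rows \<phi> L T ts (Suc j) ps =
     T_next_row \<phi> L T ps (tl ts) 1 ts +
     T_fill_rows \<phi> L T ts j (next_row \<phi> L T ps (tl ts) 1 ts) + 1"

fun T_split_groups :: "'a list \<Rightarrow> nat list \<Rightarrow> 'a list list \<Rightarrow> nat" where
  "T_split_groups ts [] gs = 1"
| "T_split_groups ts (k # ks) gs =
     T_take k ts + T_drop k ts + T_split_groups (take k ts) ks (drop k ts # gs) + 1"

definition T_solve :: "(nat \<Rightarrow> real) \<Rightarrow> ('a \<Rightarrow> real) \<Rightarrow> real \<Rightarrow> nat \<Rightarrow> 'a list \<Rightarrow> nat" where
  "T_solve \<phi> L T m xs =
     (let ts = presort L xs;
          row1 = first_row \<phi> T (L (hd ts)) 1 ts;
          row = fill_rows \<phi> L T ts (m - 1) row1;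
          p = row ! (length ts - 1)
      in T_presort L xs + T_first_row \<phi> T (L (hd ts)) 1 ts + T_fill_rows \<phi> L T ts (m - 1) row1 +
         T_length ts + T_nth row (length ts - 1) + T_split_groups ts (snd p) [] + 1)"

end

theory Submission
  imports Defs "HOL-Library.Multiset"
begin

text \<open>
  Order the groups of an arbitrary partition by their first, i.e. longest, trajectory and replace
  them by consecutive blocks of the same sizes. All trajectories before the first one of the
  \<open>r\<close>-th group belong to the \<open>r - 1\<close> earlier groups, so the \<open>r\<close>-th block starts at or after that
  trajectory. Hence no completion time increases, and contiguous partitions suffice.
\<close>

section \<open>Optimality of the recurrence\<close>

text \<open>Since the blocks keep the sizes of the groups, every interference factor is preserved
  and only the lengths at the block starts have to be compared. The obstacle to an induction on the
  number of groups is that the groups left after a removal need not occupy a prefix of the sorted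
  order: they may have gaps. \<open>dp_le\<close> therefore speaks of arbitrary disjoint sets of
  positions, retains only that everything before the start of a group is covered, and uses the
  number of covered positions as the table index. In the other direction, a finite table value is
  the makespan of a partition encoded by a list of cuts. The relation \<open>realizes\<close> serves
  both the abstract recurrence and the entries stored by the program, so
  \<open>realizes_Cons\<close> justifies the value and the returned groups alike.\<close>

fun cut_groups :: "(nat \<Rightarrow> 'a) \<Rightarrow> nat \<Rightarrow> nat list \<Rightarrow> nat \<Rightarrow> 'a set" where
  "cut_groups \<tau> i [] = (\<lambda>_. \<tau> ` {1..i})"
| "cut_groups \<tau> i (k # ks) = (cut_groups \<tau> k ks)(length ks + 2 := \<tau> ` {k+1..i})"

text \<open>Cuts are listed from the last worker down, as in the table entries, so they strictly
  decrease; the base case keeps the first worker's group nonempty as well.\<close>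

fun valid_cuts :: "nat \<Rightarrow> nat list \<Rightarrow> bool" where
  "valid_cuts i [] \<longleftrightarrow> 1 \<le> i"
| "valid_cuts i (k # ks) \<longleftrightarrow> k < i \<and> valid_cuts k ks"

text \<open>\<open>valid_cuts\<close> is recorded besides the partition property because identifying
  the list-level groups in \<open>set_split_groups\<close> relies on it.\<close>

definition realizes ::
  "('a set \<Rightarrow> real) \<Rightarrow> ('a \<Rightarrow> real) \<Rightarrow> real \<Rightarrow> (nat \<Rightarrow> 'a) \<Rightarrow> nat \<Rightarrow> nat \<Rightarrow> nat list \<Rightarrow> ereal \<Rightarrow> bool"
where
  "realizes F L T \<tau> i j ks v \<longleftrightarrow>
     length ks + 1 = j \<and> valid_cuts i ks \<and>
     partition_strategy (\<tau> ` {1..i}) j (cut_groups \<tau> i ks) \<and>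
     v = ereal (makespan F L T j (cut_groups \<tau> i ks))"

lemma partition_strategy_cong:
  "(\<And>i. i \<in> {1..m} \<Longrightarrow> g i = h i) \<Longrightarrow> partition_strategy A m g \<longleftrightarrow> partition_strategy A m h"
  by (simp add: partition_strategy_def disjoint_family_on_def)

lemma makespan_cong:
  "(\<And>i. i \<in> {1..m} \<Longrightarrow> g i = h i) \<Longrightarrow> makespan F L T m g = makespan F L T m h"
  unfolding makespan_def by (metis (no_types, lifting) image_cong)

lemma partition_strategy_Suc:
  assumes "partition_strategy A j g" "B \<noteq> {}" "A \<inter> B = {}"
  shows "partition_strategy (A \<union> B) (Suc j) (g(Suc j := B))"
proof -
  have *: "{1..Suc j} = insert (Suc j) {1..j}" by auto
  have "g i \<inter> B = {}" if "i \<in> {1..j}" for i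
    using assms that unfolding partition_strategy_def by blast
  then have "disjoint_family_on (g(Suc j := B)) {1..Suc j}"
    using assms(1) by (fastforce simp: partition_strategy_def disjoint_family_on_def le_Suc_eq)
  moreover have "(\<Union>i\<in>{1..Suc j}. (g(Suc j := B)) i) = A \<union> B"
    using assms(1) unfolding * by (auto simp: partition_strategy_def)
  ultimately show ?thesis
    using assms unfolding partition_strategy_def by auto
qed

lemma makespan_Suc:
  assumes "1 \<le> j"
  shows "makespan F L T (Suc j) (g(Suc j := B)) =
    max (makespan F L T j g) (completion_time F L T B)"
proof -
  let ?c = "completion_time F L T"
  have "(\<lambda>i. ?c ((g(Suc j := B)) i)) ` {1..Suc j} = insert (?c B) ((\<lambda>i. ?c (g i)) ` {1..j})"
  proof -
    have "{1..Suc j} = insert (Suc j) {1..j}" by auto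
    then show ?thesis by (auto simp: image_iff)
  qed
  moreover have "Max (insert (?c B) ((\<lambda>i. ?c (g i)) ` {1..j})) =
      max (?c B) (Max ((\<lambda>i. ?c (g i)) ` {1..j}))"
    using assms by (intro Max_insert) auto
  ultimately show ?thesis
    by (simp add: makespan_def max.commute)
qed

text \<open>The cut \<open>k = i - 1\<close> is always available: the last worker gets a single
  trajectory, and the remaining state still has at least as many trajectories as workers.\<close>

lemma dp_finite: "1 \<le> j \<Longrightarrow> j \<le> i \<Longrightarrow> dp F L T \<tau> i j < \<infinity>"
proof (induction F L T \<tau> i j rule: dp.induct)
  case (3 F L T \<tau> i j)
  have "dp F L T \<tau> i (Suc (Suc j)) \<le>
      max (dp F L T \<tau> (i - 1) (Suc j)) (ereal (L (\<tau> (i-1+1)) * T * F (\<tau> ` {i-1+1..i})))"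
    unfolding dp.simps by (rule INF_lower) (use 3(3) in auto)
  also have "\<dots> < \<infinity>"
    using 3(1)[of "i - 1"] 3(3) by (auto simp: max_def)
  finally show ?case .
qed auto

locale presorted_instance =
  fixes A :: "'a set" and L :: "'a \<Rightarrow> real" and T :: real
    and F :: "'a set \<Rightarrow> real" and \<phi> :: "nat \<Rightarrow> real" and \<tau> :: "nat \<Rightarrow> 'a"
  assumes T_nonneg: "0 \<le> T"
    and interference: "size_interference F \<phi>"
    and presorted: "presorted L A \<tau>"
begin

section \<open>Blocks of consecutive positions in a sorted sequence\<close>

lemma inj: "inj_on \<tau> {1..card A}"
  and image: "\<tau> ` {1..card A} = A"
  using presorted by (auto simp: presorted_def bij_betw_def)

lemma length_antimono: "1 \<le> i \<Longrightarrow> i \<le> j \<Longrightarrow> j \<le> card A \<Longrightarrow> L (\<tau> j) \<le> L (\<tau> i)"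
  using presorted by (auto simp: presorted_def monotone_on_def)

lemma interference_eq: "finite g \<Longrightarrow> g \<noteq> {} \<Longrightarrow> F g = \<phi> (card g)"
  and interference_nonneg: "1 \<le> s \<Longrightarrow> 0 \<le> \<phi> s"
  using interference by (auto simp: size_interference_def)

lemma interference_block: "k < i \<Longrightarrow> i \<le> card A \<Longrightarrow> F (\<tau> ` {k+1..i}) = \<phi> (i - k)"
  using inj by (subst interference_eq) (auto simp: card_image inj_on_subset)

text \<open>Sorting puts the longest trajectory of a block at its left end; this makes the second
  argument of \<open>max\<close> in the transition a genuine completion time.\<close>

lemma completion_time_block:
  assumes "k < i" "i \<le> card A"
  shows "completion_time F L T (\<tau> ` {k+1..i}) = L (\<tau> (k+1)) * T * F (\<tau> ` {k+1..i})"
proof -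
  have "Max (L ` \<tau> ` {k+1..i}) = L (\<tau> (k+1))"
    using assms by (intro Max_eqI) (auto intro!: length_antimono)
  then show ?thesis by (simp add: completion_time_def)
qed

text \<open>Induction on the number of groups, giving the group that starts last to the last worker.
  Only its size and its start matter: it is compared with the block of the same size that ends at
  the number of covered positions, while the other groups satisfy the hypotheses again.\<close>

lemma dp_le:
  assumes "finite I" "card I = Suc j"
    and "\<And>r. r \<in> I \<Longrightarrow> G r \<subseteq> {1..card A}" "\<And>r. r \<in> I \<Longrightarrow> G r \<noteq> {}"
    and "disjoint_family_on G I"
    and "\<And>r. r \<in> I \<Longrightarrow> {1..<Min (G r)} \<subseteq> (\<Union>r\<in>I. G r)"
    and "\<And>r. r \<in> I \<Longrightarrow> L (\<tau> (Min (G r))) * T * \<phi> (card (G r)) \<le> c"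
  shows "dp F L T \<tau> (card (\<Union>r\<in>I. G r)) (Suc j) \<le> ereal c"
  using assms
proof (induction j arbitrary: I)
  case 0
  then obtain r where I: "I = {r}" by (auto simp: card_Suc_eq)
  have fin: "finite (G r)" using 0(3)[of r] I finite_subset by blast
  have ne: "G r \<noteq> {}" using 0 I by auto
  have "Min (G r) \<in> G r" using fin ne by simp
  then have "Min (G r) \<ge> 1" using 0(3)[of r] I by auto
  \<comment> \<open>With a single group the covering hypothesis refers to that group alone, so a
    minimum above 1 would put 1 into it.\<close>
  moreover have "\<not> 1 < Min (G r)"
  proof
    assume *: "1 < Min (G r)"
    then have "1 \<in> G r" using 0(6)[of r] I by auto
    then show False using * fin Min_le by fastforce
  qed
  ultimately have min: "Min (G r) = 1" by simp
  have "card (G r) \<le> card A" using card_mono[OF _ 0(3)[of r]] I by simp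
  moreover have "0 < card (G r)" using fin ne by (simp add: card_gt_0_iff)
  ultimately show ?case
    using I 0(7)[of r] min interference_block[of 0 "card (G r)"] by simp
next
  case (Suc j)
  have fin: "finite (G r)" if "r \<in> I" for r using Suc(4)[OF that] finite_subset by blast
  have "I \<noteq> {}" using Suc(3) by auto
  \<comment> \<open>The largest minimum is chosen so that \<open>G q\<close> contains no position
    before the start of any group; removing it keeps those positions covered.\<close>
  then obtain q where q: "q \<in> I" and qmax: "\<And>r. r \<in> I \<Longrightarrow> Min (G r) \<le> Min (G q)"
    using obtains_MAX[OF \<open>finite I\<close>, of "\<lambda>r. Min (G r)"] Max_ge
    by (metis (no_types, lifting) Suc.prems(1) finite_imageI imageI)
  define J where "J = I - {q}"
  define k where "k = card (\<Union>r\<in>J. G r)"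
  define s where "s = card (G q)"
  have qdisj: "(\<Union>r\<in>J. G r) \<inter> G q = {}"
    using Suc.prems(5) q by (auto simp: J_def disjoint_family_on_def)
  have un: "(\<Union>r\<in>I. G r) = (\<Union>r\<in>J. G r) \<union> G q" using q by (auto simp: J_def)
  have finJ: "finite (\<Union>r\<in>J. G r)" using fin Suc(2) by (auto simp: J_def)
  have card_un: "card (\<Union>r\<in>I. G r) = k + s"
    unfolding un k_def s_def using qdisj finJ fin[OF q] by (rule card_Un_disjoint[rotated 2])
  have "(\<Union>r\<in>I. G r) \<subseteq> {1..card A}" using Suc.prems(3) by auto
  from card_mono[OF _ this] have kn: "k + s \<le> card A" using card_un by simp
  \<comment> \<open>For \<open>r \<in> J\<close> this is the covering hypothesis of the induction;
    for \<open>r = q\<close> it bounds the start of \<open>G q\<close> by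
    \<open>k + 1\<close>.\<close>
  have prefix: "{1..<Min (G r)} \<subseteq> (\<Union>r\<in>J. G r)" if "r \<in> I" for r
  proof
    fix x assume x: "x \<in> {1..<Min (G r)}"
    then have "x < Min (G q)" using qmax[OF that] by auto
    then have "x \<notin> G q" using fin[OF q] Min_le by (metis leD)
    then show "x \<in> (\<Union>r\<in>J. G r)" using Suc.prems(6)[OF that] x un by auto
  qed
  have s: "1 \<le> s" using fin[OF q] Suc.prems(4)[OF q] by (simp add: s_def Suc_le_eq card_gt_0_iff)
  have cJ: "card J = Suc j" using Suc.prems(1,2) q by (simp add: J_def)
  \<comment> \<open>A remaining group forces \<open>1 \<le> k\<close>, and \<open>1 \<le> s\<close>
    gives \<open>k \<le> k + s - 1\<close>; thus \<open>k\<close> lies in the range of the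
    transition.\<close>
  then obtain r where r: "r \<in> J" by fastforce
  have "G r \<subseteq> (\<Union>r\<in>J. G r)" "G r \<noteq> {}" using r Suc.prems(4) by (auto simp: J_def)
  then have "(\<Union>r\<in>J. G r) \<noteq> {}" by blast
  then have k1: "1 \<le> k" using finJ by (simp add: k_def Suc_le_eq card_gt_0_iff)
  have "card {1..<Min (G q)} \<le> k"
    unfolding k_def by (rule card_mono[OF finJ prefix[OF q]])
  then have pk: "Min (G q) \<le> k + 1" by simp
  have "Min (G q) \<in> G q" using fin[OF q] Suc.prems(4)[OF q] by simp
  then have "1 \<le> Min (G q)" using Suc.prems(3)[OF q] by auto
  \<comment> \<open>The exchange argument: the block starts no earlier than \<open>G q\<close>, so
    its longest trajectory is no longer.\<close>
  then have "L (\<tau> (k+1)) \<le> L (\<tau> (Min (G q)))"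
    using pk kn s by (intro length_antimono) auto
  then have "L (\<tau> (k+1)) * (T * \<phi> s) \<le> L (\<tau> (Min (G q))) * (T * \<phi> s)"
    by (rule mult_right_mono) (intro mult_nonneg_nonneg T_nonneg interference_nonneg s)
  also have "\<dots> \<le> c" using Suc.prems(7)[OF q] by (simp add: s_def mult.assoc)
  finally have cost: "L (\<tau> (k+1)) * T * F (\<tau> ` {k+1..k+s}) \<le> c"
    using interference_block[of k "k+s"] s kn by (simp add: mult.assoc)
  have IH: "dp F L T \<tau> k (Suc j) \<le> ereal c"
    unfolding k_def
  proof (rule Suc.IH)
    show "disjoint_family_on G J"
      using Suc.prems(5) by (auto simp: J_def disjoint_family_on_def)
  qed (use Suc.prems cJ prefix in \<open>auto simp: J_def\<close>)
  have "dp F L T \<tau> (k + s) (Suc (Suc j)) \<le>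
      max (dp F L T \<tau> k (Suc j)) (ereal (L (\<tau> (k+1)) * T * F (\<tau> ` {k+1..k+s})))"
    unfolding dp.simps by (rule INF_lower) (use k1 s in auto)
  also have "\<dots> \<le> ereal c" using IH cost by simp
  finally show ?case using card_un by simp
qed

text \<open>The groups are pulled back along \<open>\<tau>\<close> to sets of positions. Together
  these cover all positions, so the covering hypothesis of \<open>dp_le\<close> is immediate, and
  the makespan serves as the common bound \<open>c\<close>.\<close>

lemma dp_le_makespan:
  assumes "finite A" "1 \<le> m" "partition_strategy A m g"
  shows "dp F L T \<tau> (card A) m \<le> ereal (makespan F L T m g)"
proof -
  define G where "G r = {i \<in> {1..card A}. \<tau> i \<in> g r}" for r
  have sub: "g r \<subseteq> A" and ne: "g r \<noteq> {}" if "r \<in> {1..m}" for r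
    using assms(3) that by (auto simp: partition_strategy_def)
  have im: "\<tau> ` G r = g r" if "r \<in> {1..m}" for r
  proof
    show "g r \<subseteq> \<tau> ` G r"
    proof
      fix x assume x: "x \<in> g r"
      then have "x \<in> \<tau> ` {1..card A}" using sub[OF that] image by blast
      then show "x \<in> \<tau> ` G r" using x by (auto simp: G_def)
    qed
  qed (auto simp: G_def)
  have Gne: "G r \<noteq> {}" if "r \<in> {1..m}" for r
    using im[OF that] ne[OF that] by auto
  have "\<exists>r\<in>{1..m}. \<tau> i \<in> g r" if "i \<in> {1..card A}" for i
  proof -
    have "\<tau> i \<in> A" using image that by blast
    then show ?thesis using assms(3) unfolding partition_strategy_def by blast
  qed
  then have un: "(\<Union>r\<in>{1..m}. G r) = {1..card A}" by (auto simp: G_def)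
  have "dp F L T \<tau> (card (\<Union>r\<in>{1..m}. G r)) (Suc (m - 1)) \<le> ereal (makespan F L T m g)"
  proof (rule dp_le)
    show "disjoint_family_on G {1..m}"
      using assms(3) by (auto simp: partition_strategy_def disjoint_family_on_def G_def)
    fix r assume r: "r \<in> {1..m}"
    have finG: "finite (G r)" by (simp add: G_def)
    have "Min (G r) \<in> G r" using finG Gne[OF r] by simp
    then show "{1..<Min (G r)} \<subseteq> (\<Union>r\<in>{1..m}. G r)" unfolding un by (auto simp: G_def)
    have fing: "finite (g r)" using sub[OF r] assms(1) finite_subset by blast
    have "inj_on \<tau> (G r)" using inj by (rule inj_on_subset) (auto simp: G_def)
    then have card: "card (G r) = card (g r)" using im[OF r] card_image by metis
    have "L (\<tau> (Min (G r))) \<le> Max (L ` g r)"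
      using \<open>Min (G r) \<in> G r\<close> fing by (simp add: G_def)
    moreover have "0 \<le> T * \<phi> (card (g r))"
      using fing ne[OF r] T_nonneg interference_nonneg by (simp add: Suc_le_eq card_gt_0_iff)
    ultimately have "L (\<tau> (Min (G r))) * (T * \<phi> (card (g r))) \<le> Max (L ` g r) * (T * \<phi> (card (g r)))"
      by (rule mult_right_mono)
    also have "\<dots> = completion_time F L T (g r)"
      using interference_eq[OF fing ne[OF r]] by (simp add: completion_time_def)
    also have "\<dots> \<le> makespan F L T m g"
      unfolding makespan_def using r by (intro Max_ge) auto
    finally show "L (\<tau> (Min (G r))) * T * \<phi> (card (G r)) \<le> makespan F L T m g"
      by (simp add: card mult.assoc)
  qed (use assms Gne in \<open>auto simp: G_def\<close>)
  then show ?thesis using un assms(2) by simp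
qed

section \<open>Attaining finite table values by contiguous partitions\<close>

lemma realizes_Nil:
  assumes "1 \<le> i" "i \<le> card A"
  shows "realizes F L T \<tau> i 1 [] (ereal (L (\<tau> 1) * T * F (\<tau> ` {1..i})))"
  using completion_time_block[of 0 i] assms
  by (auto simp: realizes_def partition_strategy_def disjoint_family_on_def makespan_def)

lemma realizes_Cons:
  assumes "realizes F L T \<tau> k j ks v" "k < i" "i \<le> card A"
  shows "realizes F L T \<tau> i (Suc j) (k # ks)
    (max v (ereal (L (\<tau> (k+1)) * T * F (\<tau> ` {k+1..i}))))"
proof -
  \<comment> \<open>The cuts \<open>ks\<close> already describe \<open>length ks + 1 = j\<close>
    groups, so the index updated by \<open>cut_groups\<close> is the next worker.\<close>
  have j: "length ks + 2 = Suc j" "1 \<le> j" using assms(1) by (auto simp: realizes_def)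
  have "\<tau> ` {1..k} \<inter> \<tau> ` {k+1..i} = \<tau> ` ({1..k} \<inter> {k+1..i})"
    by (rule inj_on_image_Int[OF inj, symmetric]) (use assms in auto)
  then have dis: "\<tau> ` {1..k} \<inter> \<tau> ` {k+1..i} = {}" by auto
  have "{1..i} = {1..k} \<union> {k+1..i}" using assms(2) by auto
  then have un: "\<tau> ` {1..i} = \<tau> ` {1..k} \<union> \<tau> ` {k+1..i}" by (metis image_Un)
  have "partition_strategy (\<tau> ` {1..i}) (Suc j) ((cut_groups \<tau> k ks)(Suc j := \<tau> ` {k+1..i}))"
    unfolding un by (rule partition_strategy_Suc[OF _ _ dis]) (use assms in \<open>auto simp: realizes_def\<close>)
  moreover have "valid_cuts i (k # ks)" using assms by (simp add: realizes_def)
  ultimately show ?thesis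
    using assms(1) j makespan_Suc[OF j(2), of F L T "cut_groups \<tau> k ks" "\<tau> ` {k+1..i}"]
      completion_time_block[OF assms(2,3)]
    unfolding realizes_def cut_groups.simps j(1) by (auto simp: ereal_max)
qed

text \<open>A value other than \<infinity> means that the finite range of \<open>k\<close> is
  nonempty, hence the infimum is attained. At the minimizing \<open>k\<close> the preceding state is
  also below \<infinity>, and its cuts are extended by \<open>k\<close>.\<close>

lemma dp_realized:
  assumes "i \<le> card A" "dp F L T \<tau> i (Suc j) \<noteq> \<infinity>"
  shows "\<exists>ks. realizes F L T \<tau> i (Suc j) ks (dp F L T \<tau> i (Suc j))"
  using assms
proof (induction j arbitrary: i)
  case 0
  then show ?case using realizes_Nil[of i] by (auto split: if_splits)
next
  case (Suc j)
  define f where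
    "f k = max (dp F L T \<tau> k (Suc j)) (ereal (L (\<tau> (k+1)) * T * F (\<tau> ` {k+1..i})))" for k
  have eq: "dp F L T \<tau> i (Suc (Suc j)) = Inf (f ` {1..i-1})" by (simp add: f_def)
  have ne: "f ` {1..i-1} \<noteq> {}"
  proof
    assume "f ` {1..i-1} = {}"
    then show False using Suc.prems(2) unfolding eq by (simp add: top_ereal_def)
  qed
  have "Inf (f ` {1..i-1}) \<in> f ` {1..i-1}"
    using Min_in[OF _ ne] Min_Inf[OF _ ne] by simp
  then obtain k where k: "k \<in> {1..i-1}" "dp F L T \<tau> i (Suc (Suc j)) = f k"
    unfolding eq by auto
  have "dp F L T \<tau> k (Suc j) \<noteq> \<infinity>"
    using Suc.prems(2) unfolding k(2) f_def by (auto simp: max_def split: if_splits)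
  then obtain ks where "realizes F L T \<tau> k (Suc j) ks (dp F L T \<tau> k (Suc j))"
    using Suc.IH[of k] k(1) Suc.prems(1) by fastforce
  then have "realizes F L T \<tau> i (Suc (Suc j)) (k # ks) (f k)"
    unfolding f_def by (rule realizes_Cons) (use k(1) Suc.prems(1) in auto)
  then show ?case unfolding k(2) by (rule exI)
qed

lemma dp_eq_INF_makespan:
  assumes "finite A" "1 \<le> m"
  shows "dp F L T \<tau> (card A) m = (INF g\<in>{g. partition_strategy A m g}. ereal (makespan F L T m g))"
proof (rule antisym)
  show "dp F L T \<tau> (card A) m \<le> (INF g\<in>{g. partition_strategy A m g}. ereal (makespan F L T m g))"
    by (rule INF_greatest) (use assms dp_le_makespan in auto)
  show "(INF g\<in>{g. partition_strategy A m g}. ereal (makespan F L T m g)) \<le> dp F L T \<tau> (card A) m"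
  \<comment> \<open>The infinite case covers instances without any partition into \<open>m\<close>
    groups, where the infimum is taken over the empty set.\<close>
  proof (cases "dp F L T \<tau> (card A) m = \<infinity>")
    case False
    then obtain ks where "realizes F L T \<tau> (card A) m ks (dp F L T \<tau> (card A) m)"
      using dp_realized[of "card A" "m - 1"] assms(2) by auto
    then show ?thesis
      unfolding realizes_def image by (auto intro: INF_lower)
  qed simp
qed

end

section \<open>Correctness of the algorithm\<close>

lemma mset_insert_desc: "mset (insert_desc L x ys) = add_mset x (mset ys)"
  by (induction L x ys rule: insert_desc.induct) auto

lemma mset_presort: "mset (presort L xs) = mset xs"
  by (induction L xs rule: presort.induct) (auto simp: mset_insert_desc)

lemma sorted_insert_desc:
  "sorted_wrt (\<lambda>x y. L y \<le> L x) ys \<Longrightarrow> sorted_wrt (\<lambda>x y. L y \<le> L x) (insert_desc L x ys)"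
proof (induction L x ys rule: insert_desc.induct)
  case (2 L x y ys)
  have "set (insert_desc L x ys) = insert x (set ys)"
    using arg_cong[OF mset_insert_desc, of set_mset L x ys] by simp
  with 2 show ?case by fastforce
qed simp

lemma sorted_presort: "sorted_wrt (\<lambda>x y. L y \<le> L x) (presort L xs)"
  by (induction L xs rule: presort.induct) (auto simp: sorted_insert_desc)

lemma set_presort: "set (presort L xs) = set xs"
  by (metis mset_presort mset_eq_setD)

lemma length_presort: "length (presort L xs) = length xs"
  by (metis mset_presort mset_eq_length)

lemma distinct_presort: "distinct (presort L xs) = distinct xs"
  by (metis mset_presort mset_eq_imp_distinct_iff)

lemma presorted_nth:
  assumes "distinct ts" "sorted_wrt (\<lambda>x y. L y \<le> L x) ts"
  shows "presorted L (set ts) (\<lambda>i. ts ! (i - 1))"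
proof -
  have "bij_betw (\<lambda>i. i - 1) {1..length ts} {..<length ts}"
    by (rule bij_betwI[where g = Suc]) auto
  from bij_betw_trans[OF this bij_betw_nth[OF assms(1) refl refl]]
  have "bij_betw (\<lambda>i. ts ! (i - 1)) {1..length ts} (set ts)" by (simp add: comp_def)
  moreover have "L (ts ! (j - 1)) \<le> L (ts ! (i - 1))" if "1 \<le> i" "i \<le> j" "j \<le> length ts" for i j
  proof (cases "i = j")
    case False
    then show ?thesis using sorted_wrt_nth_less[OF assms(2), of "i - 1" "j - 1"] that by simp
  qed simp
  ultimately show ?thesis
    using assms(1) by (simp add: presorted_def distinct_card monotone_on_def)
qed

text \<open>List indices start at 0 and positions at 1: the positions \<open>k+1..i\<close> are the
  list indices from \<open>k\<close> to \<open>i - 1\<close>.\<close>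

lemma image_nth_take: "i \<le> length ts \<Longrightarrow> (\<lambda>i. ts ! (i - 1)) ` {k+1..i} = set (drop k (take i ts))"
proof -
  assume i: "i \<le> length ts"
  have "(\<lambda>i. ts ! (i - 1)) ` {k+1..i} = (\<lambda>i. ts ! (i - 1)) ` Suc ` {k..<i}"
    by (simp add: image_Suc_atLeastLessThan atLeastLessThanSuc_atLeastAtMost)
  also have "\<dots> = (!) ts ` {k..<i}" unfolding image_image by simp
  also have "\<dots> = set (drop k (take i ts))"
  proof -
    have "drop k (take i ts) = map ((!) ts) [k..<i]"
      using i by (intro nth_equalityI) auto
    then show ?thesis by simp
  qed
  finally show ?thesis .
qed

section \<open>Recovering the groups from the cuts\<close>

lemma split_groups_append: "split_groups ts ks (gs @ hs) = split_groups ts ks gs @ hs"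
  by (induction ts ks gs rule: split_groups.induct) auto

lemma length_split_groups: "length (split_groups ts ks gs) = length ks + 1 + length gs"
  by (induction ts ks gs rule: split_groups.induct) auto

text \<open>Stated for prefixes because each cut leaves a shorter prefix to the remaining cuts; the
  program needs the case \<open>i = length ts\<close>.\<close>

lemma set_split_groups:
  assumes "valid_cuts i ks" "i \<le> length ts" "r \<in> {1..length ks + 1}"
  shows "set (split_groups (take i ts) ks [] ! (r - 1)) = cut_groups (\<lambda>i. ts ! (i - 1)) i ks r"
  using assms
proof (induction ks arbitrary: i)
  case Nil
  then show ?case using image_nth_take[of i ts 0] by simp
next
  case (Cons k ks)
  \<comment> \<open>The accumulator is extended only at its front, so the group of the last worker
    can be peeled off as the final list element.\<close>
  have eq: "split_groups (take i ts) (k # ks) [] =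
      split_groups (take k ts) ks [] @ [drop k (take i ts)]"
    using Cons.prems split_groups_append[of "take k ts" ks "[]" "[drop k (take i ts)]"]
    by (simp add: min_def)
  have k: "k < i" "valid_cuts k ks" "k \<le> length ts" using Cons.prems by auto
  show ?case
  proof (cases "r = length ks + 2")
    case True
    then show ?thesis
      using image_nth_take[of i ts k] Cons.prems
      unfolding eq by (simp add: nth_append length_split_groups)
  next
    case False
    then have r: "r \<in> {1..length ks + 1}" using Cons.prems(3) by auto
    then have "r - 1 < length (split_groups (take k ts) ks [])"
      by (auto simp: length_split_groups)
    then have "set (split_groups (take i ts) (k # ks) [] ! (r - 1)) =
        set (split_groups (take k ts) ks [] ! (r - 1))"
      unfolding eq nth_append by simp
    also have "\<dots> = cut_groups (\<lambda>i. ts ! (i - 1)) k ks r" by (rule Cons.IH[OF k(2,3) r])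
    finally show ?thesis using False by simp
  qed
qed

text \<open>The suffixes are offset by one because the entry for the cut \<open>k\<close> meets the
  trajectory at position \<open>k + 1\<close>, which has list index \<open>k\<close>. The guard in
  the second claim excludes the empty range, whose default \<open>(\<infinity>, [])\<close> names no
  cut.\<close>

lemma best_cut_correct:
  fixes \<phi> L T i ps ts
  defines "f \<equiv> \<lambda>k. max (fst (ps ! (k - 1))) (ereal (L (ts ! k) * T * \<phi> (i - k)))"
  assumes "1 \<le> k" "i \<le> length ts" "length ps = length ts"
  shows "fst (best_cut \<phi> L T i k (drop (k - 1) ps) (drop k ts)) = (INF k\<in>{k..i-1}. f k)"
    and "fst (best_cut \<phi> L T i k (drop (k - 1) ps) (drop k ts)) \<noteq> \<infinity> \<Longrightarrow>
      \<exists>k'\<in>{k..i-1}. best_cut \<phi> L T i k (drop (k - 1) ps) (drop k ts) = (f k', k' # snd (ps ! (k' - 1)))"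
proof -
  let ?b = "\<lambda>k. best_cut \<phi> L T i k (drop (k - 1) ps) (drop k ts)"
  have "fst (?b k) = (INF k\<in>{k..i-1}. f k) \<and>
    (fst (?b k) \<noteq> \<infinity> \<longrightarrow> (\<exists>k'\<in>{k..i-1}. ?b k = (f k', k' # snd (ps ! (k' - 1)))))"
    using \<open>1 \<le> k\<close>
  proof (induction "i - k" arbitrary: k)
    case 0
    \<comment> \<open>Here \<open>1 \<le> k\<close> matters: for \<open>i = 0\<close> truncated
      subtraction makes the upper bound 0.\<close>
    then have "{k..i-1} = {}" "i \<le> k" by auto
    moreover have "?b k = (\<infinity>, [])"
      using \<open>i \<le> k\<close> by (cases "drop (k - 1) ps"; cases "drop k ts") auto
    ultimately show ?case by (simp add: top_ereal_def)
  next
    case (Suc d)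
    then have k: "k < i" "1 \<le> k" by auto
    then have d1: "drop (k - 1) ps = ps ! (k - 1) # drop k ps"
      using Cons_nth_drop_Suc[of "k - 1" ps] assms by simp
    have d2: "drop k ts = ts ! k # drop (k + 1) ts"
      using Cons_nth_drop_Suc[of k ts] assms k by simp
    have b: "?b k = (if f k \<le> fst (?b (k+1)) then (f k, k # snd (ps ! (k - 1))) else ?b (k+1))"
      using k unfolding d1 d2 by (simp add: f_def Let_def)
    have r: "{k..i-1} = insert k {k+1..i-1}" using k by auto
    have inf: "(INF k\<in>{k..i-1}. f k) = min (f k) (INF k\<in>{k+1..i-1}. f k)"
      unfolding r by (simp add: inf_min)
    have IH: "fst (?b (k+1)) = (INF k\<in>{k+1..i-1}. f k)"
      "fst (?b (k+1)) \<noteq> \<infinity> \<Longrightarrow> \<exists>k'\<in>{k+1..i-1}. ?b (k+1) = (f k', k' # snd (ps ! (k' - 1)))"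
      using Suc(1)[of "k+1"] Suc(2) by auto
    show ?case
    proof (cases "f k \<le> fst (?b (k+1))")
      case True
      then have "?b k = (f k, k # snd (ps ! (k - 1)))" using b by simp
      then show ?thesis using True k unfolding inf IH(1) by (auto simp: min_def)
    next
      case False
      then have e: "?b k = ?b (k+1)" using b by simp
      show ?thesis
        unfolding e inf using IH False by (auto simp: min_def r)
    qed
  qed
  then show "fst (?b k) = (INF k\<in>{k..i-1}. f k)"
    and "fst (?b k) \<noteq> \<infinity> \<Longrightarrow> \<exists>k'\<in>{k..i-1}. ?b k = (f k', k' # snd (ps ! (k' - 1)))" by auto
qed

section \<open>Rows of the table\<close>

lemma length_first_row: "length (first_row \<phi> T l i xs) = length xs"
  by (induction \<phi> T l i xs rule: first_row.induct) auto

lemma nth_first_row: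
  "q < length xs \<Longrightarrow> first_row \<phi> T l i xs ! q = (ereal (l * T * \<phi> (i + q)), [])"
proof (induction \<phi> T l i xs arbitrary: q rule: first_row.induct)
  case (2 \<phi> T l i x xs)
  then show ?case by (cases q) auto
qed simp

lemma length_next_row: "length (next_row \<phi> L T ps ts i xs) = length xs"
  by (induction \<phi> L T ps ts i xs rule: next_row.induct) auto

lemma nth_next_row:
  "q < length xs \<Longrightarrow> next_row \<phi> L T ps ts i xs ! q = best_cut \<phi> L T (i + q) 1 ps ts"
proof (induction \<phi> L T ps ts i xs arbitrary: q rule: next_row.induct)
  case (2 \<phi> L T ps ts i x xs)
  then show ?case by (cases q) auto
qed simp

lemma length_fill_rows: "length ps = length ts \<Longrightarrow> length (fill_rows \<phi> L T ts j ps) = length ts"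
  by (induction \<phi> L T ts j ps rule: fill_rows.induct) (auto simp: length_next_row)

locale sorted_list_instance =
  fixes ts :: "'a list" and L :: "'a \<Rightarrow> real" and T :: real
    and F :: "'a set \<Rightarrow> real" and \<phi> :: "nat \<Rightarrow> real"
  assumes T_nonneg': "0 \<le> T"
    and interference': "size_interference F \<phi>"
    and distinct_ts: "distinct ts"
    and sorted_ts: "sorted_wrt (\<lambda>x y. L y \<le> L x) ts"
begin

abbreviation \<tau> :: "nat \<Rightarrow> 'a" where "\<tau> \<equiv> \<lambda>i. ts ! (i - 1)"

sublocale presorted_instance "set ts" L T F \<phi> \<tau>
  by unfold_locales (use T_nonneg' interference' presorted_nth[OF distinct_ts sorted_ts] in auto)

lemma card_ts: "card (set ts) = length ts"
  by (rule distinct_card[OF distinct_ts])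

text \<open>Cuts are constrained only where the value is below \<infinity>, since other states have
  no partition for them to encode.\<close>

definition correct_row :: "nat \<Rightarrow> dp_entry list \<Rightarrow> bool" where
  "correct_row j ps \<longleftrightarrow> length ps = length ts \<and>
     (\<forall>i\<in>{1..length ts}. fst (ps ! (i - 1)) = dp F L T \<tau> i j \<and>
        (dp F L T \<tau> i j \<noteq> \<infinity> \<longrightarrow> realizes F L T \<tau> i j (snd (ps ! (i - 1))) (dp F L T \<tau> i j)))"

lemma correct_first_row: "correct_row (Suc 0) (first_row \<phi> T (L (hd ts)) 1 ts)"
proof -
  have "first_row \<phi> T (L (hd ts)) 1 ts ! (i - 1) = (dp F L T \<tau> i (Suc 0), []) \<and>
      realizes F L T \<tau> i (Suc 0) [] (dp F L T \<tau> i (Suc 0))"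
    if "i \<in> {1..length ts}" for i
  proof -
    have "ts \<noteq> []" using that by auto
    then show ?thesis
      using that interference_block[of 0 i] realizes_Nil[of i] card_ts
      by (auto simp: nth_first_row hd_conv_nth)
  qed
  then show ?thesis by (auto simp: correct_row_def length_first_row)
qed

lemma correct_next_row:
  assumes "correct_row (Suc j) ps"
  shows "correct_row (Suc (Suc j)) (next_row \<phi> L T ps (tl ts) 1 ts)"
  unfolding correct_row_def
proof (intro conjI ballI)
  show "length (next_row \<phi> L T ps (tl ts) 1 ts) = length ts" by (simp add: length_next_row)
  fix i assume i: "i \<in> {1..length ts}"
  define f where "f k = max (fst (ps ! (k - 1))) (ereal (L (ts ! k) * T * \<phi> (i - k)))" for k
  let ?b = "best_cut \<phi> L T i 1 ps (tl ts)"
  have len: "length ps = length ts" using assms by (simp add: correct_row_def)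
  have nth: "next_row \<phi> L T ps (tl ts) 1 ts ! (i - 1) = ?b"
    using i nth_next_row[of "i - 1" ts \<phi> L T ps "tl ts" 1] by auto
  \<comment> \<open>At \<open>k = 1\<close> the two suffixes are \<open>ps\<close> itself and
    \<open>drop 1 ts\<close>, that is, \<open>tl ts\<close>.\<close>
  note bc = best_cut_correct[of 1 i ts ps \<phi> L T, folded f_def]
  have f: "f k = max (dp F L T \<tau> k (Suc j)) (ereal (L (\<tau> (k+1)) * T * F (\<tau> ` {k+1..i})))"
    if "k \<in> {1..i-1}" for k
    using that i assms interference_block[of k i] card_ts
    by (auto simp: f_def correct_row_def)
  have "fst ?b = (INF k\<in>{1..i-1}. f k)"
    using bc(1) i len by (simp add: drop_Suc)
  also have "\<dots> = dp F L T \<tau> i (Suc (Suc j))"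
    unfolding dp.simps by (rule INF_cong[OF refl f])
  finally have fst: "fst ?b = dp F L T \<tau> i (Suc (Suc j))" .
  then show "fst (next_row \<phi> L T ps (tl ts) 1 ts ! (i - 1)) = dp F L T \<tau> i (Suc (Suc j))"
    using nth by simp
  show "dp F L T \<tau> i (Suc (Suc j)) \<noteq> \<infinity> \<longrightarrow>
    realizes F L T \<tau> i (Suc (Suc j)) (snd (next_row \<phi> L T ps (tl ts) 1 ts ! (i - 1)))
      (dp F L T \<tau> i (Suc (Suc j)))"
  proof
    assume fin: "dp F L T \<tau> i (Suc (Suc j)) \<noteq> \<infinity>"
    then obtain k where k: "k \<in> {1..i-1}" "?b = (f k, k # snd (ps ! (k - 1)))"
      using bc(2) i len fst by (auto simp: drop_Suc)
    have dpf: "dp F L T \<tau> i (Suc (Suc j)) = f k" using fst k(2) by simp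
    \<comment> \<open>A maximum below \<infinity> forces its first argument below \<infinity>, so
      the row invariant vouches for the cuts stored at \<open>k\<close>.\<close>
    then have "dp F L T \<tau> k (Suc j) \<noteq> \<infinity>"
      using fin f[OF k(1)] by (auto simp: max_def split: if_splits)
    then have "realizes F L T \<tau> k (Suc j) (snd (ps ! (k - 1))) (dp F L T \<tau> k (Suc j))"
      using assms k(1) i by (auto simp: correct_row_def)
    then have "realizes F L T \<tau> i (Suc (Suc j)) (k # snd (ps ! (k - 1))) (f k)"
      unfolding f[OF k(1)] by (rule realizes_Cons) (use k(1) i card_ts in auto)
    then show "realizes F L T \<tau> i (Suc (Suc j)) (snd (next_row \<phi> L T ps (tl ts) 1 ts ! (i - 1)))
        (dp F L T \<tau> i (Suc (Suc j)))"
      unfolding nth dpf k(2) by simp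
  qed
qed

lemma correct_fill_rows:
  "correct_row (Suc j) ps \<Longrightarrow> correct_row (Suc (j + d)) (fill_rows \<phi> L T ts d ps)"
proof (induction d arbitrary: j ps)
  case (Suc d)
  from Suc.IH[OF correct_next_row[OF Suc.prems]] show ?case by simp
qed simp

text \<open>\<open>m \<le> length ts\<close> enters through \<open>dp_finite\<close>: the final
  value is finite, and therefore its stored cuts encode a partition.\<close>

lemma final_entry_correct:
  fixes m
  defines "p \<equiv> fill_rows \<phi> L T ts (m - 1) (first_row \<phi> T (L (hd ts)) 1 ts) ! (length ts - 1)"
  defines "g \<equiv> \<lambda>i. set (split_groups ts (snd p) [] ! (i - 1))"
  assumes "1 \<le> m" "m \<le> length ts"
  shows "fst p = dp F L T \<tau> (length ts) m"
    and "length (split_groups ts (snd p) []) = m"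
    and "partition_strategy (set ts) m g"
    and "fst p = ereal (makespan F L T m g)"
proof -
  have "correct_row m (fill_rows \<phi> L T ts (m - 1) (first_row \<phi> T (L (hd ts)) 1 ts))"
    using correct_fill_rows[OF correct_first_row, of "m - 1"] assms(3) by simp
  moreover have "length ts \<in> {1..length ts}" using assms(3,4) by auto
  ultimately have fst: "fst p = dp F L T \<tau> (length ts) m"
    and "dp F L T \<tau> (length ts) m \<noteq> \<infinity> \<longrightarrow>
      realizes F L T \<tau> (length ts) m (snd p) (dp F L T \<tau> (length ts) m)"
    unfolding correct_row_def p_def by blast+
  then have r: "realizes F L T \<tau> (length ts) m (snd p) (fst p)"
    using dp_finite[OF assms(3,4), of F L T \<tau>] by simp
  show "fst p = dp F L T \<tau> (length ts) m" by (rule fst)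
  have len: "length (snd p) + 1 = m" using r by (simp add: realizes_def)
  then show "length (split_groups ts (snd p) []) = m" by (simp add: length_split_groups)
  have g: "g i = cut_groups \<tau> (length ts) (snd p) i" if "i \<in> {1..m}" for i
    using set_split_groups[of "length ts" "snd p" ts i] r that len
    by (simp add: g_def realizes_def)
  show "partition_strategy (set ts) m g"
    using r partition_strategy_cong[OF g] image by (simp add: realizes_def card_ts)
  show "fst p = ereal (makespan F L T m g)"
    using r makespan_cong[OF g] by (simp add: realizes_def)
qed

end

text \<open>Optimality is a sandwich: the returned groups attain the table value, which by
  \<open>dp_le_makespan\<close> is below the makespan of every partition.\<close>

lemma solve_correct:
  fixes L :: "'a \<Rightarrow> real"
  assumes "0 \<le> T" "size_interference F \<phi>" "1 \<le> m" "distinct xs" "m \<le> length xs"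
  defines "\<tau> \<equiv> \<lambda>i. presort L xs ! (i - 1)"
    and "v \<equiv> fst (solve \<phi> L T m xs)"
    and "gs \<equiv> snd (solve \<phi> L T m xs)"
  defines "g \<equiv> \<lambda>i. set (gs ! (i - 1))"
  shows "presorted L (set xs) \<tau>" "length gs = m"
    and "is_arg_min (makespan F L T m) (partition_strategy (set xs) m) g"
    and "v = ereal (makespan F L T m g)" "v = dp F L T \<tau> (card (set xs)) m"
proof -
  interpret sorted_list_instance "presort L xs" L T F \<phi>
    by unfold_locales (use assms in \<open>auto simp: distinct_presort sorted_presort\<close>)
  have m: "m \<le> length (presort L xs)" using assms by (simp add: length_presort)
  note final = final_entry_correct[OF \<open>1 \<le> m\<close> m]
  have card: "card (set xs) = length (presort L xs)"
    using card_ts by (simp add: set_presort)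
  show "presorted L (set xs) \<tau>"
    using presorted by (simp add: set_presort \<tau>_def)
  show "length gs = m"
    using final(2) by (simp add: gs_def solve_def Let_def)
  show v: "v = ereal (makespan F L T m g)"
    using final(4) by (simp add: v_def g_def gs_def solve_def Let_def)
  show dp: "v = dp F L T \<tau> (card (set xs)) m"
    using final(1) by (simp add: v_def \<tau>_def card solve_def Let_def)
  have part: "partition_strategy (set xs) m g"
    using final(3) by (simp add: g_def gs_def solve_def Let_def set_presort)
  have "makespan F L T m g \<le> makespan F L T m h" if "partition_strategy (set xs) m h" for h
    using dp_le_makespan[of m h] that assms(3) v dp by (simp add: set_presort \<tau>_def)
  then show "is_arg_min (makespan F L T m) (partition_strategy (set xs) m) g"
    using part by (auto simp: is_arg_min_linorder)
qed

section \<open>Running time\<close>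

lemma T_insert_desc_le: "T_insert_desc L x ys \<le> length ys + 1"
  by (induction L x ys rule: T_insert_desc.induct) auto

text \<open>With \<open>n\<close> the length of the tail, a further element costs at most
  \<open>n + 2\<close>, within the gap \<open>2 * n + 3\<close> between consecutive squares.\<close>

lemma T_presort_le: "T_presort L xs \<le> (length xs + 1)\<^sup>2"
proof (induction L xs rule: T_presort.induct)
  case (2 L x xs)
  have "T_insert_desc L x (presort L xs) \<le> length xs + 1"
    using T_insert_desc_le[of L x "presort L xs"] by (simp add: length_presort)
  with 2 show ?case by (simp add: power2_eq_square)
qed simp

lemma T_first_row_eq: "T_first_row \<phi> T l i xs = length xs + 1"
  by (induction \<phi> T l i xs rule: T_first_row.induct) auto

lemma T_best_cut_le: "T_best_cut \<phi> L T i k ps xs \<le> length xs + 1"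
  by (induction \<phi> L T i k ps xs rule: T_best_cut.induct) auto

lemma T_next_row_le: "T_next_row \<phi> L T ps ts i xs \<le> length xs * (length ts + 2) + 1"
proof (induction \<phi> L T ps ts i xs rule: T_next_row.induct)
  case (2 \<phi> L T ps ts i x xs)
  then show ?case using T_best_cut_le[of \<phi> L T i 1 ps ts] by simp
qed simp

lemma T_fill_rows_le:
  "T_fill_rows \<phi> L T ts j ps \<le> j * (length ts * (length ts + 2) + 2) + 1"
proof (induction \<phi> L T ts j ps rule: T_fill_rows.induct)
  case (2 \<phi> L T ts j ps)
  have "T_next_row \<phi> L T ps (tl ts) 1 ts \<le> length ts * (length (tl ts) + 2) + 1"
    by (rule T_next_row_le)
  also have "\<dots> \<le> length ts * (length ts + 2) + 1" by simp
  finally show ?case using 2 by simp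
qed simp

text \<open>Each cut pays for one \<open>take\<close> and one \<open>drop\<close>, at most
  \<open>length ts + 1\<close> steps each, and one for the call; the prefix only shrinks.\<close>

lemma T_split_groups_le:
  "T_split_groups ts ks gs \<le> length ks * (2 * length ts + 3) + 1"
proof (induction ts ks gs rule: T_split_groups.induct)
  case (2 ts k ks gs)
  have "length ks * (2 * length (take k ts) + 3) \<le> length ks * (2 * length ts + 3)" by simp
  with 2 have "T_split_groups (take k ts) ks (drop k ts # gs) \<le> length ks * (2 * length ts + 3) + 1"
    by linarith
  moreover have "T_take k ts \<le> length ts + 1" "T_drop k ts \<le> length ts + 1"
    by (auto simp: T_take T_drop)
  ultimately show ?case by simp
qed simp

text \<open>The time bound also covers more workers than trajectories, where
  \<open>final_entry_correct\<close> does not apply. The number of stored cuts is therefore bounded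
  from the code alone: each row adds at most one.\<close>

lemma length_cuts_best_cut:
  "\<forall>p\<in>set ps. length (snd p) \<le> j \<Longrightarrow> length (snd (best_cut \<phi> L T i k ps xs)) \<le> Suc j"
  by (induction \<phi> L T i k ps xs rule: best_cut.induct) (auto simp: Let_def)

lemma length_cuts_next_row:
  "\<forall>p\<in>set ps. length (snd p) \<le> j \<Longrightarrow>
    p \<in> set (next_row \<phi> L T ps ts i xs) \<Longrightarrow> length (snd p) \<le> Suc j"
  by (induction \<phi> L T ps ts i xs rule: next_row.induct) (auto simp: length_cuts_best_cut)

lemma length_cuts_fill_rows:
  "\<forall>p\<in>set ps. length (snd p) \<le> d \<Longrightarrow>
    p \<in> set (fill_rows \<phi> L T ts j ps) \<Longrightarrow> length (snd p) \<le> d + j"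
proof (induction \<phi> L T ts j ps arbitrary: d rule: fill_rows.induct)
  case (2 \<phi> L T ts j ps)
  have "\<forall>p\<in>set (next_row \<phi> L T ps (tl ts) 1 ts). length (snd p) \<le> Suc d"
    using length_cuts_next_row[OF 2(2)] by blast
  from 2(1)[OF this] 2(3) show ?case by simp
qed simp

lemma T_solve_le:
  assumes "xs \<noteq> []" "1 \<le> m"
  shows "T_solve \<phi> L T m xs \<le> 12 * (length xs)\<^sup>2 * m"
proof -
  define n where "n = length xs"
  define ts where "ts = presort L xs"
  define row1 where "row1 = first_row \<phi> T (L (hd ts)) 1 ts"
  define row where "row = fill_rows \<phi> L T ts (m - 1) row1"
  define p where "p = row ! (n - 1)"
  obtain d where m: "m = Suc d" using assms(2) by (cases m) auto
  have n1: "1 \<le> n" using assms(1) by (simp add: n_def Suc_le_eq)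
  have lts: "length ts = n" by (simp add: ts_def n_def length_presort)
  have lrow: "length row = n"
    by (simp add: row_def row1_def length_fill_rows length_first_row lts)
  have "\<forall>p\<in>set row1. length (snd p) \<le> 0"
    by (auto simp: row1_def in_set_conv_nth length_first_row nth_first_row)
  moreover have "p \<in> set row" using lrow n1 by (simp add: p_def)
  ultimately have "length (snd p) \<le> d"
    using length_cuts_fill_rows[of row1 0 p \<phi> L T ts d] by (simp add: row_def m)
  then have "length (snd p) * (2 * n + 3) \<le> d * (2 * n + 3)" by (rule mult_right_mono) simp
  then have split: "T_split_groups ts (snd p) [] \<le> d * (2 * n + 3) + 1"
    using T_split_groups_le[of ts "snd p" "[]"] unfolding lts by linarith
  have fill: "T_fill_rows \<phi> L T ts d row1 \<le> d * (n * (n + 2) + 2) + 1"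
    using T_fill_rows_le[of \<phi> L T ts d row1] lts by simp
  have nth: "T_nth row (n - 1) = n"
    using lrow n1 by (subst T_nth) auto
  have "T_solve \<phi> L T m xs = T_presort L xs + (n + 1) + T_fill_rows \<phi> L T ts d row1 +
      (n + 1) + n + T_split_groups ts (snd p) [] + 1"
    unfolding T_solve_def Let_def ts_def[symmetric] row1_def[symmetric] row_def[symmetric] lts
    by (simp add: nth[simplified] m p_def T_first_row_eq T_length lts)
  also have "\<dots> \<le> (n + 1)\<^sup>2 + (n + 1) + (d * (n * (n + 2) + 2) + 1) + (n + 1) + n +
      (d * (2 * n + 3) + 1) + 1"
    using T_presort_le[of L xs] fill split unfolding n_def by linarith
  also have "\<dots> = (n\<^sup>2 + 5 * n + 6) + d * (n\<^sup>2 + 4 * n + 5)"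
    by (simp add: power2_eq_square algebra_simps)
  \<comment> \<open>By \<open>n \<le> n\<^sup>2\<close> and \<open>1 \<le> n\<^sup>2\<close> the
    brackets are at most \<open>1 + 5 + 6 = 12\<close> and \<open>1 + 4 + 5 = 10\<close> times
    \<open>n\<^sup>2\<close>. The constant 12 serves for both, and \<open>1 + d = m\<close> collects
    them.\<close>
  also have "\<dots> \<le> 12 * n\<^sup>2 + d * (12 * n\<^sup>2)"
  proof -
    have "n \<le> n\<^sup>2" "1 \<le> n\<^sup>2" using n1 by (simp_all add: power2_eq_square)
    then show ?thesis by (intro add_mono mult_left_mono) linarith+
  qed
  also have "\<dots> = 12 * (length xs)\<^sup>2 * m" by (simp add: m n_def)
  finally show ?thesis .
qed

text \<open>The value claim ranges over every descending order, so it is independent of how ties are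
  broken; the claim about the returned groups assumes \<open>m \<le> card A\<close>, which ensures
  that a partition exists.\<close>

theorem mainTheorem2:
  shows
    "(\<forall>(A :: 'a set) (L :: 'a \<Rightarrow> real) (T :: real) (F :: 'a set \<Rightarrow> real) (\<phi> :: nat \<Rightarrow> real) (m :: nat).
        finite A \<and> (\<forall>t\<in>A. 0 \<le> L t) \<and> 0 \<le> T \<and> size_interference F \<phi> \<and> 1 \<le> m \<longrightarrow>
        (\<forall>\<tau>. presorted L A \<tau> \<longrightarrow>
           dp F L T \<tau> (card A) m =
             (INF g\<in>{g. partition_strategy A m g}. ereal (makespan F L T m g))) \<and>
        (\<forall>xs. distinct xs \<and> set xs = A \<and> m \<le> card A \<longrightarrow>
           (let \<tau> = (\<lambda>i. presort L xs ! (i - 1));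
                v = fst (solve \<phi> L T m xs);
                gs = snd (solve \<phi> L T m xs);
                g = (\<lambda>i. set (gs ! (i - 1)))
            in presorted L A \<tau> \<and>
               length gs = m \<and>
               is_arg_min (makespan F L T m) (partition_strategy A m) g \<and>
               v = ereal (makespan F L T m g) \<and>
               v = dp F L T \<tau> (card A) m))) \<and>
     (\<exists>C :: nat. \<forall>(\<phi> :: nat \<Rightarrow> real) (L :: 'a \<Rightarrow> real) (T :: real) (m :: nat) (xs :: 'a list).
        xs \<noteq> [] \<and> 1 \<le> m \<longrightarrow> T_solve \<phi> L T m xs \<le> C * (length xs)\<^sup>2 * m)"
proof (intro conjI allI impI)
  fix A :: "'a set" and L :: "'a \<Rightarrow> real" and T :: real and F :: "'a set \<Rightarrow> real" and \<phi> and m :: nat and \<tau>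
  assume asm: "finite A \<and> (\<forall>t\<in>A. 0 \<le> L t) \<and> 0 \<le> T \<and> size_interference F \<phi> \<and> 1 \<le> m"
  {
    assume "presorted L A \<tau>"
    then interpret presorted_instance A L T F \<phi> \<tau>
      using asm by unfold_locales auto
    show "dp F L T \<tau> (card A) m = (INF g\<in>{g. partition_strategy A m g}. ereal (makespan F L T m g))"
      using asm by (intro dp_eq_INF_makespan) auto
  }
next
  fix A :: "'a set" and L :: "'a \<Rightarrow> real" and T :: real and F :: "'a set \<Rightarrow> real" and \<phi> and m :: nat and xs
  assume asm: "finite A \<and> (\<forall>t\<in>A. 0 \<le> L t) \<and> 0 \<le> T \<and> size_interference F \<phi> \<and> 1 \<le> m"
    and xs: "distinct xs \<and> set xs = A \<and> m \<le> card A"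
  then have "m \<le> length xs" by (auto simp: distinct_card)
  with asm xs solve_correct[of T F \<phi> m xs L]
  show "let \<tau> = (\<lambda>i. presort L xs ! (i - 1));
            v = fst (solve \<phi> L T m xs);
            gs = snd (solve \<phi> L T m xs);
            g = (\<lambda>i. set (gs ! (i - 1)))
        in presorted L A \<tau> \<and>
           length gs = m \<and>
           is_arg_min (makespan F L T m) (partition_strategy A m) g \<and>
           v = ereal (makespan F L T m g) \<and>
           v = dp F L T \<tau> (card A) m"
    unfolding Let_def by blast
next
  show "\<exists>C :: nat. \<forall>(\<phi> :: nat \<Rightarrow> real) (L :: 'a \<Rightarrow> real) (T :: real) (m :: nat) (xs :: 'a list).
      xs \<noteq> [] \<and> 1 \<le> m \<longrightarrow> T_solve \<phi> L T m xs \<le> C * (length xs)\<^sup>2 * m"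
    using T_solve_le by blast
qed

end
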